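(* Let $M$ and $N$ be matroids on disjoint finite sets $S$ and $T$, let $A\subseteq S$, $B\subseteq T$, and let $P=(M,N;A,B)$. The cyclic flats of $P$ are exactly the sets of the following three kinds: (1) $Z_M\cup Z_N$ where $Z_M$ is a cyclic flat of $M$, $A\not\subseteq Z_M$, and $Z_N$ is a cyclic flat of $N\setminus B$; (2) $F_M\cup Z_N$ where $F_M$ is a flat of $M$, $A\subseteq F_M$, all coloops of the restriction $M|F_M$ are in $A$, $Z_N$ is a cyclic flat of $N$, and $Z_N\cap B\neq\emptyset$; (3) $Z_M\cup Z_N$ where $Z_M$ is a cyclic flat of $M$, $A\subseteq Z_M$, $Z_N$ is a cyclic flat of $N$, and $Z_N\cap B=\emptyset$.
   Context: A set in a matroid is cyclic if it is a (possibly empty) union of circuits; a cyclic flat is a flat that is cyclic. The principal sum $(M,N;A,B)$ is the matroid union $M^+(A,B)\vee N_0$, where: $N_0=N\oplus U_{0,S}$ ($N$ with the elements of $S$ added as loops); $M^+(A,B)$ is the matroid on $S\cup T$ obtained from $M$ by adding each element of $B$ freely (by successive principal extensions) to the flat $\mathrm{cl}_M(A)$ and each element of $T-B$ as a loop, equivalently the matroid with rank function $r(X\cup Y)=\min\{r_M(X\cup A),\,r_M(X)+|Y\cap B|\}$ for $X\subseteq S$, $Y\subseteq T$; and the matroid union $G\vee H$ of matroids on a common set has as independent sets the unions of an independent set of $G$ and an independent set of $H$. *)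

theory Defs
  imports Main
begin

record 'a indep_system =
  ground :: "'a set"
  indep :: "'a set \<Rightarrow> bool"

locale matroid =
  fixes M :: "'a indep_system"
  assumes finite_ground: "finite (ground M)"
    and indep_subset_ground: "indep M I \<Longrightarrow> I \<subseteq> ground M"
    and indep_empty: "indep M {}"
    and indep_subset: "indep M J \<Longrightarrow> I \<subseteq> J \<Longrightarrow> indep M I"
    and indep_augment: "indep M I \<Longrightarrow> indep M J \<Longrightarrow> card I < card J \<Longrightarrow>
      \<exists>x\<in>J - I. indep M (insert x I)"

definition rank :: "'a indep_system \<Rightarrow> 'a set \<Rightarrow> nat" where
  "rank M X = Max {card I | I. I \<subseteq> X \<and> indep M I}"

definition closure :: "'a indep_system \<Rightarrow> 'a set \<Rightarrow> 'a set" where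
  "closure M X = {e \<in> ground M. rank M (insert e X) = rank M X}"

definition flat :: "'a indep_system \<Rightarrow> 'a set \<Rightarrow> bool" where
  "flat M F \<longleftrightarrow> F \<subseteq> ground M \<and> closure M F = F"

definition circuit :: "'a indep_system \<Rightarrow> 'a set \<Rightarrow> bool" where
  "circuit M C \<longleftrightarrow> C \<subseteq> ground M \<and> \<not> indep M C \<and> (\<forall>D. D \<subset> C \<longrightarrow> indep M D)"

definition cyclic :: "'a indep_system \<Rightarrow> 'a set \<Rightarrow> bool" where
  "cyclic M X \<longleftrightarrow> (\<exists>\<C>. (\<forall>C\<in>\<C>. circuit M C) \<and> X = \<Union>\<C>)"

definition cyclic_flat :: "'a indep_system \<Rightarrow> 'a set \<Rightarrow> bool" where
  "cyclic_flat M Z \<longleftrightarrow> flat M Z \<and> cyclic M Z"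

definition basis :: "'a indep_system \<Rightarrow> 'a set \<Rightarrow> bool" where
  "basis M X \<longleftrightarrow> indep M X \<and> (\<forall>Y. indep M Y \<longrightarrow> X \<subseteq> Y \<longrightarrow> Y = X)"

definition coloop :: "'a indep_system \<Rightarrow> 'a \<Rightarrow> bool" where
  "coloop M e \<longleftrightarrow> e \<in> ground M \<and> (\<forall>X. basis M X \<longrightarrow> e \<in> X)"

definition restriction :: "'a indep_system \<Rightarrow> 'a set \<Rightarrow> 'a indep_system" where
  "restriction M X = \<lparr>ground = ground M \<inter> X, indep = (\<lambda>I. indep M I \<and> I \<subseteq> X)\<rparr>"

definition deletion :: "'a indep_system \<Rightarrow> 'a set \<Rightarrow> 'a indep_system" where
  "deletion M X = restriction M (ground M - X)"

definition uniform :: "nat \<Rightarrow> 'a set \<Rightarrow> 'a indep_system" where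
  "uniform k E = \<lparr>ground = E, indep = (\<lambda>I. I \<subseteq> E \<and> finite I \<and> card I \<le> k)\<rparr>"

definition direct_sum :: "'a indep_system \<Rightarrow> 'a indep_system \<Rightarrow> 'a indep_system" where
  "direct_sum M N = \<lparr>ground = ground M \<union> ground N,
     indep = (\<lambda>I. \<exists>J K. indep M J \<and> indep N K \<and> I = J \<union> K)\<rparr>"

text \<open>Used only for two matroids on a common ground set.\<close>

definition matroid_union :: "'a indep_system \<Rightarrow> 'a indep_system \<Rightarrow> 'a indep_system" where
  "matroid_union G H = \<lparr>ground = ground G \<union> ground H,
     indep = (\<lambda>I. \<exists>J K. indep G J \<and> indep H K \<and> I = J \<union> K)\<rparr>"

text \<open>The matroid on a finite set \<open>E\<close> with rank function \<open>r\<close>: a set is independent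
  iff its rank equals its cardinality.\<close>

definition matroid_of_rank :: "'a set \<Rightarrow> ('a set \<Rightarrow> nat) \<Rightarrow> 'a indep_system" where
  "matroid_of_rank E r = \<lparr>ground = E, indep = (\<lambda>I. I \<subseteq> E \<and> r I = card I)\<rparr>"

text \<open>\<open>M\<^sup>+(A,B)\<close> on \<open>S \<union> T\<close>, where \<open>S = ground M\<close>: the elements of \<open>B\<close> are added freely to the
  flat spanned by \<open>A\<close>, those of \<open>T - B\<close> as loops. A subset \<open>Z\<close> of \<open>S \<union> T\<close> is split as
  \<open>X \<union> Y\<close> with \<open>X = Z \<inter> S\<close> and \<open>Y = Z \<inter> T\<close>; its rank is
  \<open>min {r\<^sub>M(X \<union> A), r\<^sub>M(X) + |Y \<inter> B|}\<close>.\<close>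

definition free_extension ::
  "'a indep_system \<Rightarrow> 'a set \<Rightarrow> 'a set \<Rightarrow> 'a set \<Rightarrow> 'a indep_system" where
  "free_extension M T A B = matroid_of_rank (ground M \<union> T)
     (\<lambda>Z. min (rank M ((Z \<inter> ground M) \<union> A)) (rank M (Z \<inter> ground M) + card ((Z \<inter> T) \<inter> B)))"

definition principal_sum ::
  "'a indep_system \<Rightarrow> 'a indep_system \<Rightarrow> 'a set \<Rightarrow> 'a set \<Rightarrow> 'a indep_system" where
  "principal_sum M N A B =
     matroid_union (free_extension M (ground N) A B) (direct_sum N (uniform 0 (ground M)))"

end

theory Submission
  imports Defs
begin

text \<open>Write \<open>Z = X \<union> Y\<close> with \<open>X \<subseteq> S\<close>, \<open>Y \<subseteq> T\<close>. The rank of \<open>Z\<close> in the principal sum is the minimum of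
  \<open>f = r\<^sub>M(X \<union> A) + r\<^sub>N(Y)\<close> and \<open>g = r\<^sub>M(X) + r\<^sub>N(Y - B) + |Y \<inter> B|\<close>. The difference \<open>g - f\<close> can only grow
  when elements are added to \<open>Z\<close>. Hence the rank is \<open>g\<close> on all subsets of a set with \<open>g < f\<close>, and \<open>f\<close>
  on all supersets of a set with \<open>f \<le> g\<close>. Flats and cyclic sets are recognised by how the rank
  changes when one element is added or removed; the case \<open>g < f\<close> yields the cyclic flats of kind (1),
  the case \<open>f \<le> g\<close> those of kinds (2) and (3).\<close>

section \<open>Rank in hereditary systems and matroids\<close>

text \<open>The rank of the principal sum is computed before augmentation is known for it. Facts on
  rank that need only heredity are therefore proved here, and
  \<open>matroid_if_rank_submodular\<close> supplies augmentation afterwards.\<close>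

locale hereditary_system =
  fixes M :: "'a indep_system"
  assumes finite_ground: "finite (ground M)"
    and indep_subset_ground: "indep M I \<Longrightarrow> I \<subseteq> ground M"
    and indep_empty: "indep M {}"
    and indep_subset: "indep M J \<Longrightarrow> I \<subseteq> J \<Longrightarrow> indep M I"
begin

lemma indep_finite: "indep M I \<Longrightarrow> finite I"
  using finite_ground indep_subset_ground finite_subset by blast

lemma finite_indep_cards: "finite {card I | I. I \<subseteq> X \<and> indep M I}"
proof (rule finite_subset)
  show "{card I | I. I \<subseteq> X \<and> indep M I} \<subseteq> card ` Pow (ground M)"
    using indep_subset_ground by blast
qed (simp add: finite_ground)

lemma card_le_rank: "indep M I \<Longrightarrow> I \<subseteq> X \<Longrightarrow> card I \<le> rank M X"
  unfolding rank_def by (rule Max_ge[OF finite_indep_cards]) blast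

lemma obtain_indep_rank:
  obtains I where "I \<subseteq> X" "indep M I" "card I = rank M X"
proof -
  have "{card I | I. I \<subseteq> X \<and> indep M I} \<noteq> {}"
    using indep_empty by blast
  then have "rank M X \<in> {card I | I. I \<subseteq> X \<and> indep M I}"
    unfolding rank_def by (rule Max_in[OF finite_indep_cards])
  then show thesis
    using that by auto
qed

lemma rank_leI: "(\<And>I. I \<subseteq> X \<Longrightarrow> indep M I \<Longrightarrow> card I \<le> n) \<Longrightarrow> rank M X \<le> n"
  by (metis obtain_indep_rank)

lemma rank_mono: "X \<subseteq> Y \<Longrightarrow> rank M X \<le> rank M Y"
  by (meson card_le_rank order_trans rank_leI)

lemma rank_le_card: "finite X \<Longrightarrow> rank M X \<le> card X"
  by (simp add: card_mono rank_leI)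

lemma rank_indep: "indep M I \<Longrightarrow> rank M I = card I"
  by (simp add: card_le_rank indep_finite le_antisym rank_le_card)

lemma indep_iff_rank: "finite I \<Longrightarrow> indep M I \<longleftrightarrow> rank M I = card I"
  by (metis card_subset_eq obtain_indep_rank rank_indep)

text \<open>A dependent subset of \<open>X\<close> of least cardinality has no dependent proper
  subset.\<close>

lemma dependent_contains_circuit:
  assumes "X \<subseteq> ground M" "\<not> indep M X"
  obtains C where "C \<subseteq> X" "circuit M C"
proof -
  define n where "n = (LEAST n. \<exists>C \<subseteq> X. \<not> indep M C \<and> card C = n)"
  have "\<exists>C \<subseteq> X. \<not> indep M C \<and> card C = n"
    unfolding n_def by (rule LeastI_ex) (use assms in blast)
  then obtain C where C: "C \<subseteq> X" "\<not> indep M C" "card C = n"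
    by blast
  have "indep M D" if "D \<subset> C" for D
  proof (rule ccontr)
    assume "\<not> indep M D"
    then have "n \<le> card D"
      unfolding n_def using that C by (intro Least_le) blast
    moreover have "card D < card C"
      using that C assms finite_ground by (meson finite_subset psubset_card_mono)
    ultimately show False
      using C by simp
  qed
  then show thesis
    using that C assms by (auto simp: circuit_def)
qed

text \<open>By monotonicity, a rank that differs after an insertion is a larger one, so lying
  outside the closure means a strict increase.\<close>

lemma flat_iff_rank:
  "flat M F \<longleftrightarrow> F \<subseteq> ground M \<and> (\<forall>e \<in> ground M - F. rank M F < rank M (insert e F))"
proof -
  have "rank M F < rank M (insert e F) \<longleftrightarrow> rank M (insert e F) \<noteq> rank M F" for e
    using rank_mono[OF subset_insertI, of F e] by auto
  then show ?thesis
    unfolding flat_def closure_def by (auto simp: insert_absorb)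
qed

end

sublocale matroid \<subseteq> hereditary_system
  using finite_ground indep_subset_ground indep_empty indep_subset by unfold_locales

section \<open>Submodularity of rank and cyclic sets in matroids\<close>

context matroid
begin

text \<open>Induction on the number of missing elements. Augmenting from a maximum independent
  subset \<open>K\<close> of \<open>X\<close> keeps the added element inside
  \<open>X\<close>.\<close>

lemma indep_extend_to_rank:
  assumes "indep M I" "I \<subseteq> X"
  obtains J where "I \<subseteq> J" "J \<subseteq> X" "indep M J" "card J = rank M X"
proof -
  have "\<exists>J. I \<subseteq> J \<and> J \<subseteq> X \<and> indep M J \<and> card J = rank M X"
    using assms
  proof (induction "rank M X - card I" arbitrary: I)
    case 0
    then show ?case
      using card_le_rank[of I X] by auto
  next
    case (Suc k)
    obtain K where K: "K \<subseteq> X" "indep M K" "card K = rank M X"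
      by (rule obtain_indep_rank)
    moreover have "card I < card K"
      using K Suc.hyps(2) by linarith
    ultimately obtain x where x: "x \<in> K - I" "indep M (insert x I)"
      using indep_augment[of I K] Suc.prems by blast
    then have "card (insert x I) = Suc (card I)"
      using Suc.prems indep_finite by auto
    then have "k = rank M X - card (insert x I)"
      using Suc.hyps(2) by linarith
    moreover have "insert x I \<subseteq> X"
      using Suc.prems K(1) x(1) by blast
    ultimately obtain J where "insert x I \<subseteq> J" "J \<subseteq> X" "indep M J" "card J = rank M X"
      using Suc.hyps(1)[OF _ x(2)] by metis
    then show ?case
      by blast
  qed
  then show thesis
    using that by blast
qed

text \<open>A maximum independent subset \<open>I\<close> of \<open>X \<inter> Y\<close> extends to
  a maximum independent subset \<open>J\<close> of \<open>X \<union> Y\<close>. It remains to count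
  \<open>J\<close> through its traces on \<open>X\<close> and \<open>Y\<close>, whose intersection
  contains \<open>I\<close>.\<close>

lemma rank_submodular: "rank M (X \<union> Y) + rank M (X \<inter> Y) \<le> rank M X + rank M Y"
proof -
  obtain I where I: "I \<subseteq> X \<inter> Y" "indep M I" "card I = rank M (X \<inter> Y)"
    by (rule obtain_indep_rank)
  then have "I \<subseteq> X \<union> Y"
    by auto
  then obtain J where J: "I \<subseteq> J" "J \<subseteq> X \<union> Y" "indep M J" "card J = rank M (X \<union> Y)"
    using indep_extend_to_rank[OF I(2)] by metis
  have "finite J"
    using indep_finite[OF J(3)] .
  have "J = (J \<inter> X) \<union> (J \<inter> Y)" "I \<subseteq> (J \<inter> X) \<inter> (J \<inter> Y)"
    using I(1) J(1,2) by auto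
  then have "card J + card I \<le> card ((J \<inter> X) \<union> (J \<inter> Y)) + card ((J \<inter> X) \<inter> (J \<inter> Y))"
    using \<open>finite J\<close> by (metis add_left_mono card_mono finite_Int)
  also have "\<dots> = card (J \<inter> X) + card (J \<inter> Y)"
    using \<open>finite J\<close> by (intro card_Un_Int[symmetric]) auto
  also have "\<dots> \<le> rank M X + rank M Y"
    by (intro add_mono card_le_rank indep_subset[OF J(3)] Int_lower1 Int_lower2)
  finally show ?thesis
    unfolding I(3) J(4) .
qed

lemma rank_Un_le: "finite Y \<Longrightarrow> rank M (X \<union> Y) \<le> rank M X + card Y"
  using rank_submodular[of X Y] rank_le_card[of Y] by linarith

text \<open>Diminishing increments: \<open>W\<close> raises the rank of the larger set by no more
  than that of the smaller one. The additive form avoids subtraction on natural numbers.\<close>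

lemma rank_increment_antimono:
  assumes "X \<subseteq> Y"
  shows "rank M (Y \<union> W) + rank M X \<le> rank M Y + rank M (X \<union> W)"
proof -
  have "rank M X \<le> rank M (Y \<inter> (X \<union> W))"
    using assms by (intro rank_mono) auto
  moreover have "Y \<union> (X \<union> W) = Y \<union> W"
    using assms by auto
  ultimately show ?thesis
    using rank_submodular[of Y "X \<union> W"] by simp
qed

text \<open>The test can be made one element at a time: \<open>e\<close> lies in a circuit inside
  \<open>Z\<close> exactly if deleting \<open>e\<close> keeps the rank of \<open>Z\<close>.\<close>

lemma cyclic_iff_rank:
  "cyclic M Z \<longleftrightarrow> Z \<subseteq> ground M \<and> (\<forall>e \<in> Z. rank M (Z - {e}) = rank M Z)"
proof
  assume "cyclic M Z"
  then obtain \<C> where \<C>: "\<And>C. C \<in> \<C> \<Longrightarrow> circuit M C" "Z = \<Union>\<C>"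
    by (auto simp: cyclic_def)
  have "rank M (Z - {e}) = rank M Z" if "e \<in> Z" for e
  proof -
    \<comment> \<open>A circuit keeps its rank when \<open>e\<close> is removed; by diminishing
      increments, so does the larger set \<open>Z\<close>.\<close>
    obtain C where C: "C \<in> \<C>" "e \<in> C"
      using \<open>e \<in> Z\<close> \<C> by blast
    then have "circuit M C"
      using \<C> by blast
    then have "indep M (C - {e})" "\<not> indep M C" "finite C"
      using C finite_ground finite_subset by (auto simp: circuit_def)
    moreover have "Suc (card (C - {e})) = card C"
      using C \<open>finite C\<close> by (meson card_Suc_Diff1)
    ultimately have "rank M C \<le> rank M (C - {e})"
      using indep_iff_rank[of C] rank_le_card[of C] by (simp add: rank_indep)
    moreover have "C - {e} \<subseteq> Z - {e}" "(Z - {e}) \<union> {e} = Z" "(C - {e}) \<union> {e} = C"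
      using C \<C> \<open>e \<in> Z\<close> by auto
    ultimately have "rank M Z \<le> rank M (Z - {e})"
      using rank_increment_antimono[of "C - {e}" "Z - {e}" "{e}"] by simp
    then show ?thesis
      using rank_mono[of "Z - {e}" Z] by auto
  qed
  then show "Z \<subseteq> ground M \<and> (\<forall>e \<in> Z. rank M (Z - {e}) = rank M Z)"
    using \<C> by (auto simp: circuit_def)
next
  assume Z: "Z \<subseteq> ground M \<and> (\<forall>e \<in> Z. rank M (Z - {e}) = rank M Z)"
  have "\<exists>C. circuit M C \<and> C \<subseteq> Z \<and> e \<in> C" if "e \<in> Z" for e
  proof -
    \<comment> \<open>Since deleting \<open>e\<close> keeps the rank, \<open>I\<close> is also a
      maximum independent subset of \<open>Z\<close>. So \<open>insert e I\<close> is dependent, and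
      a circuit in it must use \<open>e\<close> because \<open>I\<close> is independent.\<close>
    obtain I where I: "I \<subseteq> Z - {e}" "indep M I" "card I = rank M (Z - {e})"
      by (rule obtain_indep_rank)
    have "\<not> indep M (insert e I)"
    proof
      assume "indep M (insert e I)"
      then have "card (insert e I) \<le> rank M Z"
        using I \<open>e \<in> Z\<close> by (intro card_le_rank) auto
      moreover have "card (insert e I) = Suc (card I)"
        using I indep_finite by (intro card_insert_disjoint) auto
      ultimately show False
        using I Z \<open>e \<in> Z\<close> by simp
    qed
    moreover have "insert e I \<subseteq> ground M"
      using I Z \<open>e \<in> Z\<close> by auto
    ultimately obtain C where C: "C \<subseteq> insert e I" "circuit M C"
      using dependent_contains_circuit by blast
    moreover have "e \<in> C"
    proof (rule ccontr)
      assume "e \<notin> C"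
      then have "indep M C"
        using C I indep_subset by blast
      then show False
        using C by (simp add: circuit_def)
    qed
    moreover have "insert e I \<subseteq> Z"
      using I(1) \<open>e \<in> Z\<close> by auto
    ultimately show ?thesis
      by (meson order_trans)
  qed
  then have "Z \<subseteq> \<Union>{C. circuit M C \<and> C \<subseteq> Z}"
    by (intro subsetI) simp
  then have "Z = \<Union>{C. circuit M C \<and> C \<subseteq> Z}"
    by auto
  then show "cyclic M Z"
    unfolding cyclic_def by (intro exI[of _ "{C. circuit M C \<and> C \<subseteq> Z}"]) simp
qed

section \<open>Bases, coloops, restriction and deletion in terms of rank\<close>

lemma basis_iff_card: "basis M X \<longleftrightarrow> indep M X \<and> card X = rank M (ground M)"
proof
  assume X: "basis M X"
  then have indep: "indep M X" and max: "\<And>Y. indep M Y \<Longrightarrow> X \<subseteq> Y \<Longrightarrow> Y = X"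
    unfolding basis_def by blast+
  obtain J where "X \<subseteq> J" "indep M J" "card J = rank M (ground M)"
    using indep_extend_to_rank[OF indep indep_subset_ground[OF indep]] by metis
  with indep max show "indep M X \<and> card X = rank M (ground M)"
    by metis
next
  assume X: "indep M X \<and> card X = rank M (ground M)"
  have "Y = X" if "indep M Y" "X \<subseteq> Y" for Y
  proof -
    have "card Y \<le> card X"
      using card_le_rank[OF that(1) indep_subset_ground[OF that(1)]] X by simp
    then show ?thesis
      using card_seteq[OF indep_finite[OF that(1)] that(2)] by simp
  qed
  with X show "basis M X"
    unfolding basis_def by simp
qed

text \<open>Some basis avoids \<open>e\<close> exactly if the remaining ground set still has full
  rank.\<close>

lemma coloop_iff_rank:
  "coloop M e \<longleftrightarrow> e \<in> ground M \<and> rank M (ground M - {e}) < rank M (ground M)"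
proof (cases "e \<in> ground M")
  case True
  have "(\<exists>X. basis M X \<and> e \<notin> X) \<longleftrightarrow> rank M (ground M) \<le> rank M (ground M - {e})"
  proof
    assume "\<exists>X. basis M X \<and> e \<notin> X"
    then obtain X where X: "indep M X" "card X = rank M (ground M)" and "e \<notin> X"
      unfolding basis_iff_card by blast
    then have "X \<subseteq> ground M - {e}"
      using indep_subset_ground[OF X(1)] by blast
    with X show "rank M (ground M) \<le> rank M (ground M - {e})"
      using card_le_rank by fastforce
  next
    assume le: "rank M (ground M) \<le> rank M (ground M - {e})"
    obtain X where X: "X \<subseteq> ground M - {e}" "indep M X" "card X = rank M (ground M - {e})"
      by (rule obtain_indep_rank)
    with le have "card X = rank M (ground M)"
      using rank_mono[of "ground M - {e}" "ground M"] by auto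
    with X show "\<exists>X. basis M X \<and> e \<notin> X"
      unfolding basis_iff_card by blast
  qed
  then show ?thesis
    using True unfolding coloop_def by (auto simp: not_less)
qed (simp add: coloop_def)

lemma matroid_restriction: "matroid (restriction M X)"
proof unfold_locales
  fix I J
  assume "indep (restriction M X) I" "indep (restriction M X) J" "card I < card J"
  then show "\<exists>x\<in>J - I. indep (restriction M X) (insert x I)"
    using indep_augment[of I J] by (auto simp: restriction_def)
qed (auto simp: restriction_def finite_ground indep_empty
    dest: indep_subset_ground intro: indep_subset)

lemma rank_restriction:
  assumes "Y \<subseteq> X"
  shows "rank (restriction M X) Y = rank M Y"
proof -
  have "I \<subseteq> Y \<and> indep M I \<and> I \<subseteq> X \<longleftrightarrow> I \<subseteq> Y \<and> indep M I" for I
    using assms by blast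
  then show ?thesis
    by (simp add: rank_def restriction_def)
qed

lemma coloop_restriction_iff_rank:
  assumes "F \<subseteq> ground M"
  shows "coloop (restriction M F) e \<longleftrightarrow> e \<in> F \<and> rank M (F - {e}) < rank M F"
proof -
  have "ground (restriction M F) = F"
    using assms by (auto simp: restriction_def)
  then show ?thesis
    by (simp add: matroid.coloop_iff_rank[OF matroid_restriction] rank_restriction)
qed

lemma cyclic_flat_iff_rank:
  "cyclic_flat M Z \<longleftrightarrow> Z \<subseteq> ground M \<and> (\<forall>e \<in> ground M - Z. rank M Z < rank M (insert e Z)) \<and>
    (\<forall>e \<in> Z. rank M (Z - {e}) = rank M Z)"
  by (auto simp: cyclic_flat_def flat_iff_rank cyclic_iff_rank)

lemma cyclic_flat_deletion_iff_rank:
  "cyclic_flat (deletion M X) Z \<longleftrightarrow>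
    Z \<subseteq> ground M - X \<and> (\<forall>e \<in> ground M - X - Z. rank M Z < rank M (insert e Z)) \<and>
    (\<forall>e \<in> Z. rank M (Z - {e}) = rank M Z)"
proof -
  have "ground (restriction M (ground M - X)) = ground M - X"
    by (auto simp: restriction_def)
  moreover have "rank (restriction M (ground M - X)) (Z - {e}) = rank M (Z - {e})"
    if "Z \<subseteq> ground M - X" for e
    using that by (intro rank_restriction) auto
  ultimately show ?thesis
    unfolding deletion_def matroid.cyclic_flat_iff_rank[OF matroid_restriction]
    by (auto simp: rank_restriction)
qed

end

text \<open>Suppose no element of \<open>J\<close> extends \<open>I\<close>. Then each single
  element of \<open>J\<close> leaves the rank of \<open>I\<close> unchanged, and submodularity
  carries this over to all of \<open>J\<close>. So \<open>I \<union> J\<close> has rank at most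
  \<open>card I\<close>, yet it contains the larger independent set \<open>J\<close>.\<close>

lemma (in hereditary_system) matroid_if_rank_submodular:
  assumes submodular: "\<And>X Y. rank M (X \<union> Y) + rank M (X \<inter> Y) \<le> rank M X + rank M Y"
  shows "matroid M"
proof unfold_locales
  fix I J
  assume I: "indep M I" and J: "indep M J" and less: "card I < card J"
  show "\<exists>x\<in>J - I. indep M (insert x I)"
  proof (rule ccontr)
    assume dep: "\<not> (\<exists>x\<in>J - I. indep M (insert x I))"
    have *: "rank M (insert x I) \<le> rank M I" if "x \<in> J" for x
    proof (cases "x \<in> I")
      case False
      have "finite (insert x I)" "card (insert x I) = Suc (card I)"
        using I indep_finite False by auto
      with dep show ?thesis
        using that False indep_iff_rank[of "insert x I"] rank_le_card[of "insert x I"]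
          rank_indep[OF I] by auto
    qed (simp add: insert_absorb)
    have "rank M (I \<union> K) \<le> rank M I" if "K \<subseteq> J" "finite K" for K
      using that(2,1)
    proof induction
      case (insert x K)
      have "rank M I \<le> rank M ((I \<union> K) \<inter> insert x I)"
        by (intro rank_mono) auto
      moreover have "(I \<union> K) \<union> insert x I = I \<union> insert x K"
        by auto
      ultimately show ?case
        using submodular[of "I \<union> K" "insert x I"] insert * by fastforce
    qed simp
    then have "rank M (I \<union> J) \<le> card I"
      using J indep_finite rank_indep[OF I] by auto
    then show False
      using less card_le_rank[OF J, of "I \<union> J"] by auto
  qed
qed (fact finite_ground indep_subset_ground indep_empty indep_subset)+

section \<open>The rank of the principal sum\<close>

locale principal_sum_data = M: matroid M + N: matroid N
  for M N :: "'a indep_system" +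
  fixes A B :: "'a set"
  assumes disjoint: "ground M \<inter> ground N = {}"
    and A_subset: "A \<subseteq> ground M"
    and B_subset: "B \<subseteq> ground N"
begin

abbreviation "P \<equiv> principal_sum M N A B"

text \<open>The two bounds f and g of the overview. Up to the constant \<open>rank M A\<close>, the
  first is the rank in the direct sum of \<open>N\<close> and the contraction of \<open>M\<close> by
  \<open>A\<close>, with \<open>A\<close> kept as loops. The second is the rank in the direct sum of
  \<open>M\<close>, \<open>N\<close> without \<open>B\<close>, and the free matroid on
  \<open>B\<close>.\<close>

definition "spanned_rank X Y = rank M (X \<union> A) + rank N Y"
definition "free_rank X Y = rank M X + rank N (Y - B) + card (Y \<inter> B)"

lemma finite_B: "finite B"
  using B_subset N.finite_ground finite_subset by blast

section \<open>Independent sets of the principal sum\<close>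

lemma ground_principal_sum: "ground P = ground M \<union> ground N"
  by (auto simp: principal_sum_def matroid_union_def free_extension_def matroid_of_rank_def
      direct_sum_def uniform_def)

text \<open>The second term of the rank is at most \<open>card X + card Y\<close>, with equality
  only for independent \<open>X\<close> and \<open>Y \<subseteq> B\<close>. What then remains is the
  bound by the first term.\<close>

lemma indep_free_extension:
  assumes "X \<subseteq> ground M" "Y \<subseteq> ground N"
  shows "indep (free_extension M (ground N) A B) (X \<union> Y) \<longleftrightarrow>
    indep M X \<and> Y \<subseteq> B \<and> card X + card Y \<le> rank M (X \<union> A)"
proof -
  have [simp]: "(X \<union> Y) \<inter> ground M = X" "(X \<union> Y) \<inter> ground N = Y"
    using assms disjoint by auto
  have fin: "finite X" "finite Y"
    using assms M.finite_ground N.finite_ground finite_subset by blast+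
  have card: "card (X \<union> Y) = card X + card Y"
    using fin assms disjoint by (intro card_Un_disjoint) auto
  have "card (Y \<inter> B) \<le> card Y" "rank M X \<le> card X"
    using fin by (auto intro: card_mono M.rank_le_card)
  moreover have "card (Y \<inter> B) = card Y \<longleftrightarrow> Y \<subseteq> B"
    using fin by (metis card_subset_eq inf.absorb_iff1 inf_le1)
  ultimately show ?thesis
    using assms M.indep_iff_rank[OF fin(1)]
    by (auto simp: free_extension_def matroid_of_rank_def card min_def)
qed

text \<open>Elements of \<open>ground M\<close> are loops in the second matroid of the union, so
  \<open>X\<close> is covered by the free extension alone. \<open>Y\<close> is covered by a part
  \<open>U\<close> from the free extension and a part \<open>V\<close> independent in
  \<open>N\<close>; the two may overlap.\<close>

lemma indep_principal_sum:
  assumes "X \<subseteq> ground M" "Y \<subseteq> ground N"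
  shows "indep P (X \<union> Y) \<longleftrightarrow> indep M X \<and>
    (\<exists>U V. Y = U \<union> V \<and> U \<subseteq> B \<and> indep N V \<and> card X + card U \<le> rank M (X \<union> A))"
    (is "_ \<longleftrightarrow> ?R")
proof -
  let ?G = "free_extension M (ground N) A B"
  \<comment> \<open>The uniform matroid of rank zero contributes only the empty set, so the direct
    sum has the same independent sets as \<open>N\<close>.\<close>
  have "L \<subseteq> ground M \<and> finite L \<and> card L \<le> 0 \<longleftrightarrow> L = {}" for L
    by auto
  then have "indep (direct_sum N (uniform 0 (ground M))) K \<longleftrightarrow> indep N K" for K
    by (simp add: direct_sum_def uniform_def)
  then have "indep P (X \<union> Y) \<longleftrightarrow> (\<exists>J V. indep ?G J \<and> indep N V \<and> X \<union> Y = J \<union> V)"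
    by (simp add: principal_sum_def matroid_union_def)
  also have "\<dots> \<longleftrightarrow> ?R"
  proof
    assume "\<exists>J V. indep ?G J \<and> indep N V \<and> X \<union> Y = J \<union> V"
    then obtain J V where J: "indep ?G J" and V: "indep N V" and eq: "X \<union> Y = J \<union> V"
      by blast
    have sub: "V \<subseteq> ground N"
      using V N.indep_subset_ground by blast
    have "J = (J \<inter> ground M) \<union> (J \<inter> ground N)"
      using J by (auto simp: free_extension_def matroid_of_rank_def)
    moreover have "J \<inter> ground M = X"
      using eq assms sub disjoint by blast
    moreover have "Y = (J \<inter> ground N) \<union> V"
      using eq assms sub disjoint by blast
    ultimately show ?R
      using J V assms indep_free_extension[of X "J \<inter> ground N"] by auto
  next
    assume ?R
    then obtain U V where "indep M X" "Y = U \<union> V" "U \<subseteq> B" "indep N V"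
      "card X + card U \<le> rank M (X \<union> A)"
      by blast
    moreover from this have "indep ?G (X \<union> U)"
      using assms indep_free_extension[of X U] by auto
    ultimately show "\<exists>J V. indep ?G J \<and> indep N V \<and> X \<union> Y = J \<union> V"
      by (metis Un_assoc)
  qed
  finally show ?thesis .
qed

lemma indep_principal_sum_subset_ground:
  assumes "indep P I"
  shows "I \<subseteq> ground M \<union> ground N"
  using assms N.indep_subset_ground
  by (auto simp: principal_sum_def matroid_union_def free_extension_def matroid_of_rank_def
      direct_sum_def uniform_def)

text \<open>The witnesses \<open>U\<close> and \<open>V\<close> are intersected with the subset. The
  bound on cardinalities survives because shrinking \<open>X'\<close> to \<open>X\<close> lowers the
  rank of the union with \<open>A\<close> by no more than the number of removed elements.\<close>

lemma hereditary_principal_sum: "hereditary_system P"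
proof unfold_locales
  show "finite (ground P)"
    using M.finite_ground N.finite_ground by (simp add: ground_principal_sum)
  show "I \<subseteq> ground P" if "indep P I" for I
    using indep_principal_sum_subset_ground[OF that] by (simp add: ground_principal_sum)
  show "indep P {}"
    using indep_principal_sum[of "{}" "{}"] M.indep_empty N.indep_empty by auto
  fix I J
  assume J: "indep P J" and "I \<subseteq> J"
  define X X' Y Y' where defs: "X = I \<inter> ground M" "X' = J \<inter> ground M"
    "Y = I \<inter> ground N" "Y' = J \<inter> ground N"
  have I_eq: "I = X \<union> Y" and J_eq: "J = X' \<union> Y'"
    using indep_principal_sum_subset_ground[OF J] \<open>I \<subseteq> J\<close> defs by auto
  then have "indep M X'"
    and "\<exists>U V. Y' = U \<union> V \<and> U \<subseteq> B \<and> indep N V \<and> card X' + card U \<le> rank M (X' \<union> A)"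
    using J indep_principal_sum[of X' Y'] defs by auto
  then obtain U V where UV: "Y' = U \<union> V" "U \<subseteq> B" "indep N V" "card X' + card U \<le> rank M (X' \<union> A)"
    by blast
  have sub: "X \<subseteq> X'" "Y \<subseteq> Y'"
    using \<open>I \<subseteq> J\<close> defs by auto
  have fin: "finite X'"
    using \<open>indep M X'\<close> M.indep_finite by blast
  have "rank M ((X \<union> A) \<union> (X' - X)) \<le> rank M (X \<union> A) + card (X' - X)"
    using fin by (intro M.rank_Un_le) auto
  moreover have "(X \<union> A) \<union> (X' - X) = X' \<union> A"
    using sub by auto
  moreover have "card X' = card X + card (X' - X)"
    using sub fin by (metis add.commute card_Diff_subset card_mono finite_subset le_add_diff_inverse2)
  moreover have "card (U \<inter> Y) \<le> card U"
    using UV finite_B finite_subset by (intro card_mono) auto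
  ultimately have "card X + card (U \<inter> Y) \<le> rank M (X \<union> A)"
    using UV(4) by simp
  moreover have "Y = (U \<inter> Y) \<union> (V \<inter> Y)" "U \<inter> Y \<subseteq> B"
    using UV(1,2) sub by auto
  moreover have "indep N (V \<inter> Y)"
    using N.indep_subset[OF UV(3)] by simp
  moreover have "indep M X"
    using M.indep_subset[OF \<open>indep M X'\<close> sub(1)] .
  moreover have "X \<subseteq> ground M" "Y \<subseteq> ground N"
    using defs by auto
  ultimately show "indep P I"
    unfolding I_eq using indep_principal_sum[of X Y] by blast
qed

interpretation P: hereditary_system P
  by (rule hereditary_principal_sum)

text \<open>The upper bound counts an independent set in two ways: by its parts \<open>U\<close> and
  \<open>V\<close>, and by its elements inside and outside \<open>B\<close>. The lower bound comes
  from an independent set built to reach the smaller of the two values.\<close>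

lemma rank_principal_sum:
  assumes "X \<subseteq> ground M" "Y \<subseteq> ground N"
  shows "rank P (X \<union> Y) = min (spanned_rank X Y) (free_rank X Y)"
proof (rule antisym)
  show "rank P (X \<union> Y) \<le> min (spanned_rank X Y) (free_rank X Y)"
  proof (rule P.rank_leI)
    fix I
    assume "I \<subseteq> X \<union> Y" and "indep P I"
    define X' Y' where defs: "X' = I \<inter> X" "Y' = I \<inter> Y"
    have I_eq: "I = X' \<union> Y'"
      using \<open>I \<subseteq> X \<union> Y\<close> defs by auto
    have "X' \<subseteq> ground M" "Y' \<subseteq> ground N"
      using defs assms by auto
    then have "indep M X'"
      and "\<exists>U V. Y' = U \<union> V \<and> U \<subseteq> B \<and> indep N V \<and> card X' + card U \<le> rank M (X' \<union> A)"
      using \<open>indep P I\<close> indep_principal_sum[of X' Y'] unfolding I_eq by blast+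
    then obtain U V where UV: "Y' = U \<union> V" "U \<subseteq> B" "indep N V"
      "card X' + card U \<le> rank M (X' \<union> A)"
      by blast
    have fin: "finite U" "finite V"
      using UV finite_B finite_subset N.indep_finite by blast+
    have I_card: "card I \<le> card X' + card Y'"
      unfolding I_eq by (rule card_Un_le)
    have "rank M (X' \<union> A) \<le> rank M (X \<union> A)"
      using defs by (intro M.rank_mono) auto
    moreover have "card V \<le> rank N Y"
      using UV defs by (intro N.card_le_rank) auto
    moreover have "card Y' \<le> card U + card V"
      unfolding UV by (rule card_Un_le)
    ultimately have "card I \<le> spanned_rank X Y"
      using I_card UV by (simp add: spanned_rank_def)
    have "card X' \<le> rank M X"
      using \<open>indep M X'\<close> defs by (intro M.card_le_rank) auto
    moreover have "card (V - B) \<le> rank N (Y - B)"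
      using UV defs by (intro N.card_le_rank) (auto intro: N.indep_subset)
    moreover have "card (Y' \<inter> B) \<le> card (Y \<inter> B)"
      using defs finite_B by (intro card_mono) auto
    \<comment> \<open>Since \<open>U\<close> lies in \<open>B\<close>, all elements of
      \<open>Y'\<close> outside \<open>B\<close> come from \<open>V\<close>.\<close>
    moreover have "card Y' \<le> card (V - B) + card (Y' \<inter> B)"
    proof -
      have "Y' = (V - B) \<union> (Y' \<inter> B)"
        using UV by auto
      then show ?thesis
        by (metis card_Un_le)
    qed
    ultimately have "card I \<le> free_rank X Y"
      using I_card by (simp add: free_rank_def)
    with \<open>card I \<le> spanned_rank X Y\<close> show "card I \<le> min (spanned_rank X Y) (free_rank X Y)"
      by simp
  qed
next
  obtain X' where X': "X' \<subseteq> X" "indep M X'" "card X' = rank M X"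
    by (rule M.obtain_indep_rank)
  \<comment> \<open>A maximum independent subset \<open>V\<close> of \<open>Y\<close> is grown from
    one of \<open>Y - B\<close>. It thus uses as few elements of \<open>B\<close> as possible and
    leaves the others for \<open>U\<close>.\<close>
  obtain C where C: "C \<subseteq> Y - B" "indep N C" "card C = rank N (Y - B)"
    by (rule N.obtain_indep_rank)
  obtain V where V: "C \<subseteq> V" "V \<subseteq> Y" "indep N V" "card V = rank N Y"
    using N.indep_extend_to_rank[of C Y] C by blast
  have finV: "finite V"
    using V N.indep_finite by blast
  have "card C \<le> card (V - B)"
    using C(1) V(1) finV by (intro card_mono) auto
  moreover have "card V = card (V - B) + card (V \<inter> B)"
    using finV by (metis card_Diff_subset_Int card_mono finite_Int inf_le1 le_add_diff_inverse2)
  ultimately have VB: "rank N (Y - B) + card (V \<inter> B) \<le> rank N Y"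
    using C(3) V(4) by simp
  have YB: "card (Y \<inter> B) = card (Y \<inter> B - V) + card (V \<inter> B)"
  proof -
    have "Y \<inter> B = (Y \<inter> B - V) \<union> (V \<inter> B)"
      using V by auto
    moreover have "card ((Y \<inter> B - V) \<union> (V \<inter> B)) = card (Y \<inter> B - V) + card (V \<inter> B)"
      using finite_B finV by (intro card_Un_disjoint) auto
    ultimately show ?thesis
      by simp
  qed
  define k where "k = min (rank M (X \<union> A) - rank M X) (card (Y \<inter> B - V))"
  obtain U where U: "U \<subseteq> Y \<inter> B - V" "card U = k"
    using obtain_subset_with_card_n[of k "Y \<inter> B - V"] k_def by auto
  have finU: "finite U"
    using U finite_B by (meson Diff_subset finite_Int finite_subset)
  have le: "rank M X \<le> rank M (X \<union> A)"
    by (intro M.rank_mono) auto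
  \<comment> \<open>\<open>X'\<close> spans \<open>X\<close>, so by diminishing increments
    \<open>X\<close> adds no rank to \<open>X' \<union> A\<close> either.\<close>
  have spanned: "rank M (X \<union> A) \<le> rank M (X' \<union> A)"
  proof -
    have "rank M (X' \<union> A \<union> X) + rank M X' \<le> rank M (X' \<union> A) + rank M (X' \<union> X)"
      by (intro M.rank_increment_antimono) auto
    moreover have "X' \<union> X = X" "X' \<union> A \<union> X = X \<union> A"
      using X' by auto
    ultimately show ?thesis
      using X' M.rank_indep by simp
  qed
  have "card X' + card U \<le> rank M (X' \<union> A)"
    using spanned U X' le by (simp add: k_def)
  moreover have "X' \<subseteq> ground M" "U \<union> V \<subseteq> ground N" "U \<subseteq> B"
    using X' U V assms by auto
  ultimately have "indep P (X' \<union> (U \<union> V))"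
    using indep_principal_sum[of X' "U \<union> V"] X' V by blast
  then have "card (X' \<union> (U \<union> V)) \<le> rank P (X \<union> Y)"
    using X' U V by (intro P.card_le_rank) auto
  moreover have "card (X' \<union> (U \<union> V)) = card X' + card (U \<union> V)"
  proof (rule card_Un_disjoint)
    show "X' \<inter> (U \<union> V) = {}"
      using X'(1) U(1) V(2) assms disjoint by blast
  qed (use X'(2) M.indep_finite finU finV in auto)
  moreover have "card (U \<union> V) = card U + card V"
    using finU finV U(1) by (intro card_Un_disjoint) auto
  ultimately show "min (spanned_rank X Y) (free_rank X Y) \<le> rank P (X \<union> Y)"
    using VB YB U X' V le unfolding k_def spanned_rank_def free_rank_def by linarith
qed

text \<open>The growth of g - f, in additive form. In \<open>M\<close> it is diminishing increments.
  In \<open>N\<close>, new elements outside \<open>B\<close> raise the rank of \<open>Y\<close> by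
  no more than that of \<open>Y - B\<close>, while a new element of \<open>B\<close> counts fully in
  \<open>free_rank\<close> and raises \<open>rank N\<close> by at most one.\<close>

lemma slack_mono:
  assumes "X \<subseteq> X'" "Y \<subseteq> Y'"
  shows "spanned_rank X' Y' + free_rank X Y \<le> spanned_rank X Y + free_rank X' Y'"
proof -
  have "rank M (X \<union> A \<union> X') + rank M X \<le> rank M (X \<union> A) + rank M (X \<union> X')"
    by (intro M.rank_increment_antimono) auto
  moreover have "X \<union> A \<union> X' = X' \<union> A" "X \<union> X' = X'"
    using assms by auto
  ultimately have X: "rank M (X' \<union> A) + rank M X \<le> rank M (X \<union> A) + rank M X'"
    by simp
  \<comment> \<open>The new elements outside \<open>B\<close> are added to \<open>Y\<close> first,
    then those in \<open>B\<close>.\<close>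
  have "rank N (Y \<union> (Y' - B)) + rank N (Y - B) \<le> rank N Y + rank N ((Y - B) \<union> (Y' - B))"
    by (intro N.rank_increment_antimono) auto
  moreover have "(Y - B) \<union> (Y' - B) = Y' - B"
    using assms by auto
  moreover have "rank N (Y \<union> (Y' - B) \<union> (Y' \<inter> B - Y)) \<le> rank N (Y \<union> (Y' - B)) + card (Y' \<inter> B - Y)"
    using finite_B by (intro N.rank_Un_le) auto
  moreover have "Y \<union> (Y' - B) \<union> (Y' \<inter> B - Y) = Y'"
    using assms by auto
  moreover have "card (Y' \<inter> B) = card (Y \<inter> B) + card (Y' \<inter> B - Y)"
  proof -
    have "Y' \<inter> B = (Y \<inter> B) \<union> (Y' \<inter> B - Y)"
      using assms by auto
    moreover have "card ((Y \<inter> B) \<union> (Y' \<inter> B - Y)) = card (Y \<inter> B) + card (Y' \<inter> B - Y)"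
      using finite_B by (intro card_Un_disjoint) auto
    ultimately show ?thesis
      by simp
  qed
  ultimately show ?thesis
    using X by (simp add: spanned_rank_def free_rank_def)
qed

section \<open>Submodularity of the rank of the principal sum\<close>

lemma spanned_rank_submodular:
  "spanned_rank (X \<union> X') (Y \<union> Y') + spanned_rank (X \<inter> X') (Y \<inter> Y')
    \<le> spanned_rank X Y + spanned_rank X' Y'"
proof -
  have "(X \<union> A) \<union> (X' \<union> A) = X \<union> X' \<union> A" "(X \<union> A) \<inter> (X' \<union> A) = X \<inter> X' \<union> A"
    by auto
  then show ?thesis
    using M.rank_submodular[of "X \<union> A" "X' \<union> A"] N.rank_submodular[of Y Y']
    by (simp add: spanned_rank_def)
qed

lemma free_rank_submodular:
  "free_rank (X \<union> X') (Y \<union> Y') + free_rank (X \<inter> X') (Y \<inter> Y')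
    \<le> free_rank X Y + free_rank X' Y'"
proof -
  have "(Y - B) \<union> (Y' - B) = Y \<union> Y' - B" "(Y - B) \<inter> (Y' - B) = Y \<inter> Y' - B"
    "(Y \<inter> B) \<union> (Y' \<inter> B) = (Y \<union> Y') \<inter> B" "(Y \<inter> B) \<inter> (Y' \<inter> B) = (Y \<inter> Y') \<inter> B"
    by auto
  then show ?thesis
    using M.rank_submodular[of X X'] N.rank_submodular[of "Y - B" "Y' - B"]
      card_Un_Int[of "Y \<inter> B" "Y' \<inter> B"] finite_B
    by (simp add: free_rank_def)
qed

text \<open>If the same bound is the smaller one at both pairs, its own submodularity suffices. In
  the mixed case the union is bounded by \<open>spanned_rank\<close> and the intersection by
  \<open>free_rank\<close>; \<open>slack_mono\<close>, applied to the intersection and one of the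
  pairs, exchanges the bounds there.\<close>

lemma min_rank_submodular:
  defines "r \<equiv> \<lambda>X Y. min (spanned_rank X Y) (free_rank X Y)"
  shows "r (X \<union> X') (Y \<union> Y') + r (X \<inter> X') (Y \<inter> Y') \<le> r X Y + r X' Y'"
proof -
  have "spanned_rank (X \<union> X') (Y \<union> Y') + free_rank (X \<inter> X') (Y \<inter> Y') \<le> spanned_rank X Y + free_rank X' Y'"
    using slack_mono[of "X \<inter> X'" X' "Y \<inter> Y'" Y'] spanned_rank_submodular[of X X' Y Y'] by simp
  moreover have
    "spanned_rank (X \<union> X') (Y \<union> Y') + free_rank (X \<inter> X') (Y \<inter> Y') \<le> free_rank X Y + spanned_rank X' Y'"
    using slack_mono[of "X \<inter> X'" X "Y \<inter> Y'" Y] spanned_rank_submodular[of X X' Y Y'] by simp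
  ultimately show ?thesis
    using spanned_rank_submodular[of X X' Y Y'] free_rank_submodular[of X X' Y Y']
    unfolding r_def by linarith
qed

lemma matroid_principal_sum: "matroid P"
proof (rule P.matroid_if_rank_submodular)
  fix Z Z' :: "'a set"
  define r where "r X Y = min (spanned_rank X Y) (free_rank X Y)" for X Y
  \<comment> \<open>Submodularity is required for arbitrary sets, so elements outside the ground set
    are discarded first; they do not affect the rank.\<close>
  have rank: "rank P Z = r (Z \<inter> ground M) (Z \<inter> ground N)" for Z
  proof -
    have "I \<subseteq> Z \<and> indep P I \<longleftrightarrow> I \<subseteq> Z \<inter> ground M \<union> Z \<inter> ground N \<and> indep P I" for I
      using indep_principal_sum_subset_ground by blast
    then have "rank P Z = rank P (Z \<inter> ground M \<union> Z \<inter> ground N)"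
      by (simp add: rank_def)
    then show ?thesis
      by (simp add: rank_principal_sum r_def)
  qed
  have "(Z \<inter> E) \<union> (Z' \<inter> E) = (Z \<union> Z') \<inter> E" "(Z \<inter> E) \<inter> (Z' \<inter> E) = (Z \<inter> Z') \<inter> E" for E
    by auto
  then show "rank P (Z \<union> Z') + rank P (Z \<inter> Z') \<le> rank P Z + rank P Z'"
    using min_rank_submodular[of "Z \<inter> ground M" "Z' \<inter> ground M" "Z \<inter> ground N" "Z' \<inter> ground N"]
    unfolding rank r_def by simp
qed

section \<open>Cyclic flats of the principal sum\<close>

lemma cyclic_flat_principal_sum_iff_rank:
  fixes X Y
  defines "r \<equiv> \<lambda>X Y. min (spanned_rank X Y) (free_rank X Y)"
  assumes "X \<subseteq> ground M" "Y \<subseteq> ground N"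
  shows "cyclic_flat P (X \<union> Y) \<longleftrightarrow>
    (\<forall>e \<in> ground M - X. r X Y < r (insert e X) Y) \<and> (\<forall>e \<in> ground N - Y. r X Y < r X (insert e Y)) \<and>
    (\<forall>e \<in> X. r (X - {e}) Y = r X Y) \<and> (\<forall>e \<in> Y. r X (Y - {e}) = r X Y)"
proof -
  have r: "rank P (X \<union> Y) = r X Y"
    using assms rank_principal_sum by simp
  have "rank P (insert e (X \<union> Y)) = r (insert e X) Y" if "e \<in> ground M" for e
    using assms that rank_principal_sum[of "insert e X" Y] by simp
  moreover have "rank P (insert e (X \<union> Y)) = r X (insert e Y)" if "e \<in> ground N" for e
    using assms that rank_principal_sum[of X "insert e Y"] by simp
  moreover have "rank P (X \<union> Y - {e}) = r (X - {e}) Y" if "e \<in> X" for e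
  proof -
    have "X \<union> Y - {e} = (X - {e}) \<union> Y"
      using assms that disjoint by auto
    moreover have "X - {e} \<subseteq> ground M"
      using assms by auto
    ultimately show ?thesis
      using assms rank_principal_sum[of "X - {e}" Y] by simp
  qed
  moreover have "rank P (X \<union> Y - {e}) = r X (Y - {e})" if "e \<in> Y" for e
  proof -
    have "X \<union> Y - {e} = X \<union> (Y - {e})"
      using assms that disjoint by auto
    moreover have "Y - {e} \<subseteq> ground N"
      using assms by auto
    ultimately show ?thesis
      using assms rank_principal_sum[of X "Y - {e}"] by simp
  qed
  moreover have "ground P - (X \<union> Y) = (ground M - X) \<union> (ground N - Y)"
    using assms disjoint by (auto simp: ground_principal_sum)
  moreover have "X \<union> Y \<subseteq> ground P"
    using assms by (auto simp: ground_principal_sum)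
  ultimately show ?thesis
    unfolding matroid.cyclic_flat_iff_rank[OF matroid_principal_sum] r
    by (simp add: ball_Un)
qed

text \<open>Here the principal sum looks locally like the direct sum of \<open>M\<close>,
  \<open>N\<close> without \<open>B\<close>, and coloops on \<open>B\<close>. A cyclic flat of that
  sum avoids \<open>B\<close> and splits into cyclic flats of the first two summands.\<close>

lemma cyclic_flat_principal_sum_free:
  assumes X: "X \<subseteq> ground M" and Y: "Y \<subseteq> ground N"
    and less: "free_rank X Y < spanned_rank X Y"
  shows "cyclic_flat P (X \<union> Y) \<longleftrightarrow> cyclic_flat M X \<and> cyclic_flat (deletion N B) Y"
proof -
  define r where "r X Y = min (spanned_rank X Y) (free_rank X Y)" for X Y
  have below: "r X' Y' = free_rank X' Y'" if "X' \<subseteq> X" "Y' \<subseteq> Y" for X' Y'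
    using slack_mono[OF that] less by (simp add: r_def)
  \<comment> \<open>On supersets the other bound may take over, but it still exceeds
    \<open>free_rank X Y\<close>. So a strict increase of \<open>r\<close> is the same as one of
    \<open>free_rank\<close>.\<close>
  have above: "r X Y < r X' Y' \<longleftrightarrow> free_rank X Y < free_rank X' Y'" if "X \<subseteq> X'" "Y \<subseteq> Y'" for X' Y'
  proof -
    have "spanned_rank X Y \<le> spanned_rank X' Y'"
      unfolding spanned_rank_def using that by (intro add_mono M.rank_mono N.rank_mono) auto
    then show ?thesis
      using less by (auto simp: r_def)
  qed
  have finYB: "finite (Y \<inter> B)"
    using finite_B by simp
  \<comment> \<open>Elements of \<open>B\<close> act as coloops for \<open>free_rank\<close>:
    removing one always lowers it, adding one always raises it. So cyclicity keeps \<open>Y\<close>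
    disjoint from \<open>B\<close>, and flatness tests only elements outside
    \<open>B\<close>.\<close>
  have B_loss: "free_rank X (Y - {e}) < free_rank X Y" if "e \<in> Y \<inter> B" for e
  proof -
    have "(Y - {e}) - B = Y - B" "(Y - {e}) \<inter> B = Y \<inter> B - {e}"
      using that by auto
    moreover have "card (Y \<inter> B - {e}) < card (Y \<inter> B)"
      by (rule card_Diff1_less[OF finYB that])
    ultimately show ?thesis
      by (simp only: free_rank_def)
  qed
  have B_gain: "free_rank X Y < free_rank X (insert e Y)" if "e \<in> B - Y" for e
  proof -
    have "insert e Y - B = Y - B" "insert e Y \<inter> B = insert e (Y \<inter> B)"
      using that by auto
    then show ?thesis
      using finYB that by (simp add: free_rank_def)
  qed
  have "cyclic_flat P (X \<union> Y) \<longleftrightarrow>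
    (\<forall>e \<in> ground M - X. free_rank X Y < free_rank (insert e X) Y) \<and>
    (\<forall>e \<in> ground N - Y. free_rank X Y < free_rank X (insert e Y)) \<and>
    (\<forall>e \<in> X. free_rank (X - {e}) Y = free_rank X Y) \<and>
    (\<forall>e \<in> Y. free_rank X (Y - {e}) = free_rank X Y)"
    unfolding cyclic_flat_principal_sum_iff_rank[OF X Y] r_def[symmetric]
      above[OF subset_insertI subset_refl] above[OF subset_refl subset_insertI]
    by (simp add: below)
  also have "\<dots> \<longleftrightarrow> cyclic_flat M X \<and> cyclic_flat (deletion N B) Y"
  proof (cases "Y \<inter> B = {}")
    case True
    have gain: "free_rank X Y < free_rank X (insert e Y) \<longleftrightarrow> e \<in> B \<or> rank N Y < rank N (insert e Y)"
      if "e \<notin> Y" for e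
    proof (cases "e \<in> B")
      case False
      then have "insert e Y - B = insert e Y" "insert e Y \<inter> B = {}" "Y - B = Y"
        using True by auto
      then show ?thesis
        using True False by (simp add: free_rank_def)
    qed (use B_gain that in simp)
    have loss: "free_rank X (Y - {e}) = free_rank X Y \<longleftrightarrow> rank N (Y - {e}) = rank N Y" for e
    proof -
      have "Y - {e} - B = Y - {e}" "(Y - {e}) \<inter> B = {}" "Y - B = Y"
        using True by auto
      then show ?thesis
        using True by (simp add: free_rank_def)
    qed
    have "(\<forall>e \<in> ground N - Y. free_rank X Y < free_rank X (insert e Y)) \<longleftrightarrow>
        (\<forall>e \<in> ground N - B - Y. rank N Y < rank N (insert e Y))"
      using gain by auto
    then show ?thesis
      unfolding M.cyclic_flat_iff_rank N.cyclic_flat_deletion_iff_rank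
      using X Y True by (auto simp: loss) (auto simp: free_rank_def)
  next
    case False
    then obtain e where "e \<in> Y \<inter> B"
      by blast
    then show ?thesis
      using B_loss[of e] N.cyclic_flat_deletion_iff_rank[of B Y] by auto
  qed
  finally show ?thesis .
qed

text \<open>Insertions are governed by \<open>spanned_rank\<close>, which treats \<open>A\<close> as
  already present; hence flatness forces \<open>A \<subseteq> X\<close>. After a deletion
  \<open>free_rank\<close> may become the smaller bound, and whether this can happen harmfully
  depends on whether \<open>Y\<close> meets \<open>B\<close>.\<close>

lemma cyclic_flat_principal_sum_spanned:
  assumes X: "X \<subseteq> ground M" and Y: "Y \<subseteq> ground N"
    and le: "spanned_rank X Y \<le> free_rank X Y"
  shows "cyclic_flat P (X \<union> Y) \<longleftrightarrow> flat M X \<and> A \<subseteq> X \<and> cyclic_flat N Y \<and>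
    (if Y \<inter> B = {} then cyclic M X else {e. coloop (restriction M X) e} \<subseteq> A)"
proof -
  define r where "r X Y = min (spanned_rank X Y) (free_rank X Y)" for X Y
  have above: "r X' Y' = spanned_rank X' Y'" if "X \<subseteq> X'" "Y \<subseteq> Y'" for X' Y'
    using slack_mono[OF that] le by (simp add: r_def)
  have "(\<forall>e \<in> ground M - X. r X Y < r (insert e X) Y) \<longleftrightarrow>
      (\<forall>e \<in> ground M - X. rank M (X \<union> A) < rank M (insert e (X \<union> A)))"
    by (simp add: above subset_insertI) (simp add: spanned_rank_def)
  also have "\<dots> \<longleftrightarrow> flat M X \<and> A \<subseteq> X"
  proof
    assume *: "\<forall>e \<in> ground M - X. rank M (X \<union> A) < rank M (insert e (X \<union> A))"
    \<comment> \<open>Inserting an element of \<open>A\<close> leaves \<open>X \<union> A\<close>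
      unchanged, so no such element may lie outside \<open>X\<close>.\<close>
    have "A \<subseteq> X"
    proof
      fix e
      assume "e \<in> A"
      then show "e \<in> X"
        using * A_subset by (metis DiffI UnI2 insert_absorb nat_less_le subsetD)
    qed
    with * show "flat M X \<and> A \<subseteq> X"
      using X by (simp add: M.flat_iff_rank Un_absorb2)
  qed (simp add: M.flat_iff_rank Un_absorb2)
  finally have flat_X: "(\<forall>e \<in> ground M - X. r X Y < r (insert e X) Y) \<longleftrightarrow> flat M X \<and> A \<subseteq> X" .
  have flat_Y: "(\<forall>e \<in> ground N - Y. r X Y < r X (insert e Y)) \<longleftrightarrow> flat N Y"
    using Y by (simp add: above subset_insertI N.flat_iff_rank) (simp add: spanned_rank_def)
  \<comment> \<open>A deletion keeps the minimum exactly if it keeps \<open>spanned_rank\<close> and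
    \<open>free_rank\<close> does not fall below that value.\<close>
  have drop: "r X' Y' = r X Y \<longleftrightarrow>
      spanned_rank X' Y' = spanned_rank X Y \<and> spanned_rank X Y \<le> free_rank X' Y'"
    if "X' \<subseteq> X" "Y' \<subseteq> Y" for X' Y'
  proof -
    have "spanned_rank X' Y' \<le> spanned_rank X Y"
      unfolding spanned_rank_def using that by (intro add_mono M.rank_mono N.rank_mono) auto
    then show ?thesis
      using le by (auto simp: r_def)
  qed
  have "(\<forall>e \<in> X. r (X - {e}) Y = r X Y) \<and> (\<forall>e \<in> Y. r X (Y - {e}) = r X Y) \<longleftrightarrow>
      cyclic N Y \<and> (if Y \<inter> B = {} then cyclic M X else {e. coloop (restriction M X) e} \<subseteq> A)"
    if "A \<subseteq> X"
  proof -
    have XA: "X \<union> A = X"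
      using that by auto
    have spanned_Y: "spanned_rank X (Y - {e}) = spanned_rank X Y \<longleftrightarrow> rank N (Y - {e}) = rank N Y" for e
      by (simp add: spanned_rank_def)
    show ?thesis
    proof (cases "Y \<inter> B = {}")
      \<comment> \<open>Both bounds now equal \<open>rank M X + rank N Y\<close>, so there is no
        slack: every element of \<open>X\<close>, also one of \<open>A\<close>, must be removable
        without loss of rank in \<open>M\<close>.\<close>
      case True
      then have [simp]: "Y - B = Y" "Y - {e} - B = Y - {e}" "(Y - {e}) \<inter> B = {}" for e
        by auto
      have "r (X - {e}) Y = r X Y \<longleftrightarrow> rank M (X - {e}) = rank M X" for e
      proof -
        have "rank M (X - {e}) \<le> rank M (X - {e} \<union> A)" "rank M (X - {e} \<union> A) \<le> rank M X"
          "rank M (X - {e}) \<le> rank M X"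
          using that by (auto intro: M.rank_mono)
        then show ?thesis
          using True by (auto simp: drop spanned_rank_def free_rank_def XA)
      qed
      moreover have "r X (Y - {e}) = r X Y \<longleftrightarrow> rank N (Y - {e}) = rank N Y" for e
        using True by (auto simp: drop spanned_rank_def free_rank_def XA)
      ultimately show ?thesis
        using True X Y by (auto simp: M.cyclic_iff_rank N.cyclic_iff_rank)
    next
      case False
      then obtain b where b: "b \<in> Y" "b \<in> B"
        by blast
      \<comment> \<open>For \<open>e\<close> in \<open>A\<close> the set
        \<open>X - {e} \<union> A\<close> is still \<open>X\<close>, so coloops in \<open>A\<close>
        do no harm; for other \<open>e\<close> it is \<open>X - {e}\<close>.\<close>
      have coloops: "{e. coloop (restriction M X) e} \<subseteq> A \<longleftrightarrow>
          (\<forall>e \<in> X. rank M (X - {e} \<union> A) = rank M X)"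
      proof -
        have "(coloop (restriction M X) e \<longrightarrow> e \<in> A) \<longleftrightarrow> rank M (X - {e} \<union> A) = rank M X"
          if "e \<in> X" for e
        proof (cases "e \<in> A")
          case True
          then have "X - {e} \<union> A = X"
            using \<open>A \<subseteq> X\<close> by auto
          then show ?thesis
            using True by simp
        next
          case False
          then have "X - {e} \<union> A = X - {e}"
            using \<open>A \<subseteq> X\<close> by auto
          then show ?thesis
            using False that M.rank_mono[of "X - {e}" X]
            by (auto simp: M.coloop_restriction_iff_rank[OF X])
        qed
        then show ?thesis
          using M.coloop_restriction_iff_rank[OF X] by blast
      qed
      \<comment> \<open>For cyclic \<open>Y\<close>, the element \<open>b\<close> of
        \<open>Y \<inter> B\<close> is redundant in \<open>N\<close> but counted in
        \<open>free_rank\<close>, so the gap is at least one. This absorbs the deletion of one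
        element of \<open>X\<close>, which costs \<open>free_rank\<close> at most one.\<close>
      have slack: "spanned_rank X Y < free_rank X Y" if "cyclic N Y"
      proof -
        have "rank N Y = rank N (Y - {b})"
          using that b by (simp add: N.cyclic_iff_rank)
        also have "Y - {b} = (Y - B) \<union> (Y \<inter> B - {b})"
          using b by auto
        also have "rank N \<dots> \<le> rank N (Y - B) + card (Y \<inter> B - {b})"
          using finite_B by (intro N.rank_Un_le) auto
        also have "\<dots> < rank N (Y - B) + card (Y \<inter> B)"
          using b finite_B by (intro add_strict_left_mono card_Diff1_less) auto
        finally show ?thesis
          by (simp add: spanned_rank_def free_rank_def XA)
      qed
      have X_drop: "free_rank X Y \<le> Suc (free_rank (X - {e}) Y)" for e
      proof -
        have "rank M X \<le> rank M ((X - {e}) \<union> {e})"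
          by (intro M.rank_mono) auto
        also have "\<dots> \<le> rank M (X - {e}) + card {e}"
          by (intro M.rank_Un_le) auto
        finally show ?thesis
          by (simp add: free_rank_def)
      qed
      \<comment> \<open>Counting elements of \<open>B\<close> one by one never gives less than their
        contribution to the rank in \<open>N\<close>, so \<open>free_rank\<close> stays high enough
        whenever \<open>rank N\<close> is kept.\<close>
      have Y_drop: "spanned_rank X Y \<le> free_rank X (Y - {e})"
        if "rank N (Y - {e}) = rank N Y" for e
      proof -
        have "(Y - {e} - B) \<union> ((Y - {e}) \<inter> B) = Y - {e}"
          by auto
        then have "rank N (Y - {e}) \<le> rank N (Y - {e} - B) + card ((Y - {e}) \<inter> B)"
          using N.rank_Un_le[of "(Y - {e}) \<inter> B" "Y - {e} - B"] finite_B by simp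
        then show ?thesis
          using that by (simp add: spanned_rank_def free_rank_def XA)
      qed
      have "(\<forall>e \<in> Y. r X (Y - {e}) = r X Y) \<longleftrightarrow> cyclic N Y"
        using Y Y_drop by (auto simp: drop spanned_Y N.cyclic_iff_rank)
      moreover have "(\<forall>e \<in> X. r (X - {e}) Y = r X Y) \<longleftrightarrow> {e. coloop (restriction M X) e} \<subseteq> A"
        if "cyclic N Y"
      proof -
        have "spanned_rank X Y \<le> free_rank (X - {e}) Y" for e
          using slack[OF that] X_drop[of e] by simp
        then show ?thesis
          by (simp add: coloops drop) (simp add: spanned_rank_def XA)
      qed
      ultimately show ?thesis
        using False by auto
    qed
  qed
  then show ?thesis
    unfolding cyclic_flat_principal_sum_iff_rank[OF X Y] r_def[symmetric] flat_X flat_Y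
      cyclic_flat_def[of N]
    by blast
qed

text \<open>The parts in \<open>M\<close> agree, and adding \<open>Y \<inter> B\<close> to
  \<open>Y - B\<close> raises the rank in \<open>N\<close> by at most its cardinality. Hence kinds
  (2) and (3) never occur in the case g < f.\<close>

lemma spanned_rank_le_free_rank:
  assumes "A \<subseteq> X"
  shows "spanned_rank X Y \<le> free_rank X Y"
proof -
  have "X \<union> A = X" "(Y - B) \<union> (Y \<inter> B) = Y"
    using assms by auto
  then show ?thesis
    using N.rank_Un_le[of "Y \<inter> B" "Y - B"] finite_B by (simp add: spanned_rank_def free_rank_def)
qed

text \<open>One element of \<open>A\<close> outside the flat \<open>X\<close> already raises the
  rank in \<open>M\<close>, while the parts in \<open>N\<close> agree. Hence kind (1) never occurs
  in the case f \<le> g.\<close>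

lemma free_rank_less_spanned_rank:
  assumes "flat M X" "\<not> A \<subseteq> X" "Y \<inter> B = {}"
  shows "free_rank X Y < spanned_rank X Y"
proof -
  obtain a where a: "a \<in> A" "a \<in> ground M - X"
    using assms A_subset by blast
  then have "rank M X < rank M (insert a X)"
    using assms by (simp add: M.flat_iff_rank)
  also have "\<dots> \<le> rank M (X \<union> A)"
    using a by (intro M.rank_mono) auto
  finally show ?thesis
    using assms by (simp add: spanned_rank_def free_rank_def Diff_triv)
qed

text \<open>Each kind determines which bound is the smaller one, so comparing the bounds separates
  kind (1) from the others. Kinds (2) and (3) are then told apart by whether \<open>Y\<close> meets
  \<open>B\<close>.\<close>

lemma cyclic_flat_principal_sum:
  assumes X: "X \<subseteq> ground M" and Y: "Y \<subseteq> ground N"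
  shows "cyclic_flat P (X \<union> Y) \<longleftrightarrow>
    (cyclic_flat M X \<and> \<not> A \<subseteq> X \<and> cyclic_flat (deletion N B) Y) \<or>
    (flat M X \<and> A \<subseteq> X \<and> {e. coloop (restriction M X) e} \<subseteq> A \<and> cyclic_flat N Y \<and> Y \<inter> B \<noteq> {}) \<or>
    (cyclic_flat M X \<and> A \<subseteq> X \<and> cyclic_flat N Y \<and> Y \<inter> B = {})"
proof (cases "free_rank X Y < spanned_rank X Y")
  case True
  then have "\<not> A \<subseteq> X"
    using spanned_rank_le_free_rank[of X Y] by auto
  then show ?thesis
    using cyclic_flat_principal_sum_free[OF X Y True] by blast
next
  case False
  have "A \<subseteq> X" if "cyclic_flat M X" "cyclic_flat (deletion N B) Y"
  proof (rule ccontr)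
    assume "\<not> A \<subseteq> X"
    moreover have "flat M X" "Y \<inter> B = {}"
      using that by (auto simp: cyclic_flat_def[of M] N.cyclic_flat_deletion_iff_rank)
    ultimately show False
      using False free_rank_less_spanned_rank by blast
  qed
  then show ?thesis
    using cyclic_flat_principal_sum_spanned[OF X Y] False
    by (auto simp: not_less cyclic_flat_def[of M])
qed

end

section \<open>From the criterion for pairs to the three families of sets\<close>

theorem theorem3p12:
  fixes M N :: "'a indep_system" and S T A B :: "'a set"
  assumes "matroid M" and "matroid N"
    and "ground M = S" and "ground N = T" and "S \<inter> T = {}"
    and "A \<subseteq> S" and "B \<subseteq> T"
  shows "{Z. cyclic_flat (principal_sum M N A B) Z} =
      {Z\<^sub>M \<union> Z\<^sub>N | Z\<^sub>M Z\<^sub>N. cyclic_flat M Z\<^sub>M \<and> \<not> A \<subseteq> Z\<^sub>M \<and> cyclic_flat (deletion N B) Z\<^sub>N}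
    \<union> {F\<^sub>M \<union> Z\<^sub>N | F\<^sub>M Z\<^sub>N. flat M F\<^sub>M \<and> A \<subseteq> F\<^sub>M \<and> {e. coloop (restriction M F\<^sub>M) e} \<subseteq> A \<and>
         cyclic_flat N Z\<^sub>N \<and> Z\<^sub>N \<inter> B \<noteq> {}}
    \<union> {Z\<^sub>M \<union> Z\<^sub>N | Z\<^sub>M Z\<^sub>N. cyclic_flat M Z\<^sub>M \<and> A \<subseteq> Z\<^sub>M \<and> cyclic_flat N Z\<^sub>N \<and> Z\<^sub>N \<inter> B = {}}"
proof -
  interpret M: matroid M by fact
  interpret N: matroid N by fact
  interpret principal_sum_data M N A B
    using assms by unfold_locales auto
  define kind1 where "kind1 X Y \<longleftrightarrow>
    cyclic_flat M X \<and> \<not> A \<subseteq> X \<and> cyclic_flat (deletion N B) Y" for X Y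
  define kind2 where "kind2 X Y \<longleftrightarrow> flat M X \<and> A \<subseteq> X \<and>
    {e. coloop (restriction M X) e} \<subseteq> A \<and> cyclic_flat N Y \<and> Y \<inter> B \<noteq> {}" for X Y
  define kind3 where "kind3 X Y \<longleftrightarrow>
    cyclic_flat M X \<and> A \<subseteq> X \<and> cyclic_flat N Y \<and> Y \<inter> B = {}" for X Y
  note kind_defs = kind1_def kind2_def kind3_def
  have cyclic_flat_P: "cyclic_flat P (X \<union> Y) \<longleftrightarrow> kind1 X Y \<or> kind2 X Y \<or> kind3 X Y"
    if "X \<subseteq> ground M" "Y \<subseteq> ground N" for X Y
    unfolding kind_defs by (rule cyclic_flat_principal_sum[OF that])
  \<comment> \<open>Each kind confines \<open>X\<close> to \<open>ground M\<close> and
    \<open>Y\<close> to \<open>ground N\<close>, so the criterion for pairs applies to every member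
    of the three families.\<close>
  have ground: "X \<subseteq> ground M" "Y \<subseteq> ground N" if "kind1 X Y \<or> kind2 X Y \<or> kind3 X Y" for X Y
    using that unfolding kind_defs cyclic_flat_def[of M] cyclic_flat_def[of N] flat_def
      N.cyclic_flat_deletion_iff_rank by blast+
  \<comment> \<open>The three families share this shape; naming it keeps the kinds opaque in the two
    inclusions.\<close>
  define unions :: "('a set \<Rightarrow> 'a set \<Rightarrow> bool) \<Rightarrow> 'a set set"
    where "unions K = {X \<union> Y | X Y. K X Y}" for K
  have unionsI: "X \<union> Y \<in> unions K" if "K X Y" for K X Y
    unfolding unions_def using that by (intro CollectI exI[of _ X] exI[of _ Y]) simp
  have unionsE: "\<exists>X Y. Z = X \<union> Y \<and> K X Y" if "Z \<in> unions K" for Z K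
    using that unfolding unions_def by (rule CollectD)
  have "{Z. cyclic_flat P Z} = unions kind1 \<union> unions kind2 \<union> unions kind3"
    (is "?L = ?R")
  proof
    show "?L \<subseteq> ?R"
    proof
      fix Z
      assume "Z \<in> ?L"
      then have Z: "cyclic_flat P Z"
        by simp
      then have "Z \<subseteq> ground M \<union> ground N"
        by (simp add: cyclic_flat_def flat_def ground_principal_sum)
      then obtain X Y where XY: "X \<subseteq> ground M" "Y \<subseteq> ground N" "Z = X \<union> Y"
        by (rule subset_UnE)
      have "kind1 X Y \<or> kind2 X Y \<or> kind3 X Y"
        using Z cyclic_flat_P[OF XY(1,2)] unfolding XY(3) by blast
      then show "Z \<in> ?R"
        unfolding XY(3) using unionsI[of kind1] unionsI[of kind2] unionsI[of kind3] by blast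
    qed
    show "?R \<subseteq> ?L"
    proof
      fix Z
      assume "Z \<in> ?R"
      then obtain X Y where Z: "Z = X \<union> Y" and kind: "kind1 X Y \<or> kind2 X Y \<or> kind3 X Y"
        using unionsE by (metis Un_iff)
      show "Z \<in> ?L"
        using cyclic_flat_P[OF ground[OF kind]] kind by (simp add: Z)
    qed
  qed
  then show ?thesis
    unfolding unions_def kind_defs .
qed

end
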